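(* Let $\mathcal{C}$ be a precoherent category. A sieve in $\mathcal{C}$ is a covering sieve for the coherent topology if and only if it contains a finite effective epimorphic family.
   Context: A family of morphisms $(f_i\colon X_i\to B)_{i\in I}$ is effective epimorphic if for every object $W$ and every family $(e_i\colon X_i\to W)_{i\in I}$ such that $e_i\circ g_i=e_j\circ g_j$ whenever $i,j\in I$, $g_i\colon Z\to X_i$, $g_j\colon Z\to X_j$ satisfy $f_i\circ g_i=f_j\circ g_j$, there is a unique $d\colon B\to W$ with $d\circ f_i=e_i$ for all $i$. A category is precoherent if for every finite effective epimorphic family $(\pi_i\colon X_i\to B)_{i\in I}$ and every morphism $f\colon B'\to B$ there is a finite effective epimorphic family $(\pi'_j\colon X'_j\to B')_{j\in J}$ such that each $f\circ\pi'_j$ factors through some $\pi_i$. The coherent topology on a precoherent category is the smallest Grothendieck topology in which the sieve generated by each finite effective epimorphic family is a covering sieve. A sieve on $B$ contains a family $(f_i\colon X_i\to B)_i$ if every $f_i$ belongs to it. *)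

theory Defs
  imports Main
begin

record ('o, 'a) cat =
  Obj :: "'o set"
  Arr :: "'a set"
  Dom :: "'a \<Rightarrow> 'o"
  Cod :: "'a \<Rightarrow> 'o"
  Ident :: "'o \<Rightarrow> 'a"
  Comp :: "'a \<Rightarrow> 'a \<Rightarrow> 'a" (infixr "\<cdot>\<index>" 70)

definition Hom :: "('o, 'a, 'z) cat_scheme \<Rightarrow> 'o \<Rightarrow> 'o \<Rightarrow> 'a set" where
  "Hom C X Y = {f \<in> Arr C. Dom C f = X \<and> Cod C f = Y}"

(* Composition is a total function, constrained only on composable arrows;
   g \<cdot> f means "g after f". *)
locale category =
  fixes C :: "('o, 'a, 'z) cat_scheme" (structure)
  assumes Dom_Obj: "f \<in> Arr C \<Longrightarrow> Dom C f \<in> Obj C"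
    and Cod_Obj: "f \<in> Arr C \<Longrightarrow> Cod C f \<in> Obj C"
    and Ident_Hom: "X \<in> Obj C \<Longrightarrow> Ident C X \<in> Hom C X X"
    and Comp_Hom: "\<lbrakk>f \<in> Hom C X Y; g \<in> Hom C Y Z\<rbrakk> \<Longrightarrow> g \<cdot> f \<in> Hom C X Z"
    and Ident_left: "f \<in> Hom C X Y \<Longrightarrow> Ident C Y \<cdot> f = f"
    and Ident_right: "f \<in> Hom C X Y \<Longrightarrow> f \<cdot> Ident C X = f"
    and Comp_assoc: "\<lbrakk>f \<in> Hom C W X; g \<in> Hom C X Y; h \<in> Hom C Y Z\<rbrakk>
                      \<Longrightarrow> (h \<cdot> g) \<cdot> f = h \<cdot> (g \<cdot> f)"

(* The source X_i of the member f_i of a family is Dom C (f i). The index set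
   may be empty. *)
definition effective_epi_family ::
    "('o, 'a, 'z) cat_scheme \<Rightarrow> 'i set \<Rightarrow> ('i \<Rightarrow> 'a) \<Rightarrow> 'o \<Rightarrow> bool" where
  "effective_epi_family C I f B \<longleftrightarrow>
     B \<in> Obj C \<and> (\<forall>i\<in>I. f i \<in> Hom C (Dom C (f i)) B) \<and>
     (\<forall>W\<in>Obj C. \<forall>e.
        (\<forall>i\<in>I. e i \<in> Hom C (Dom C (f i)) W) \<longrightarrow>
        (\<forall>i\<in>I. \<forall>j\<in>I. \<forall>Z\<in>Obj C.
           \<forall>g\<in>Hom C Z (Dom C (f i)). \<forall>h\<in>Hom C Z (Dom C (f j)).
             f i \<cdot>\<^bsub>C\<^esub> g = f j \<cdot>\<^bsub>C\<^esub> h \<longrightarrow> e i \<cdot>\<^bsub>C\<^esub> g = e j \<cdot>\<^bsub>C\<^esub> h) \<longrightarrow>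
        (\<exists>!d. d \<in> Hom C B W \<and> (\<forall>i\<in>I. d \<cdot>\<^bsub>C\<^esub> f i = e i)))"

(* Finite families are indexed, without loss of generality, by finite sets of
   natural numbers: quantifying over them inside a definition requires a fixed
   index type. *)
definition finite_effective_epi_family ::
    "('o, 'a, 'z) cat_scheme \<Rightarrow> nat set \<Rightarrow> (nat \<Rightarrow> 'a) \<Rightarrow> 'o \<Rightarrow> bool" where
  "finite_effective_epi_family C I f B \<longleftrightarrow> finite I \<and> effective_epi_family C I f B"

locale precoherent_category = category +
  assumes precoherent:
    "\<lbrakk>finite_effective_epi_family C I p B; f \<in> Hom C B' B\<rbrakk> \<Longrightarrow>
       \<exists>J q. finite_effective_epi_family C J q B' \<and>
         (\<forall>j\<in>J. \<exists>i\<in>I. \<exists>g\<in>Hom C (Dom C (q j)) (Dom C (p i)). f \<cdot> q j = p i \<cdot> g)"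

definition sieve :: "('o, 'a, 'z) cat_scheme \<Rightarrow> 'o \<Rightarrow> 'a set \<Rightarrow> bool" where
  "sieve C B S \<longleftrightarrow>
     B \<in> Obj C \<and> S \<subseteq> {h \<in> Arr C. Cod C h = B} \<and>
     (\<forall>h\<in>S. \<forall>Z\<in>Obj C. \<forall>g\<in>Hom C Z (Dom C h). h \<cdot>\<^bsub>C\<^esub> g \<in> S)"

definition maximal_sieve :: "('o, 'a, 'z) cat_scheme \<Rightarrow> 'o \<Rightarrow> 'a set" where
  "maximal_sieve C B = {h \<in> Arr C. Cod C h = B}"

definition pullback_sieve :: "('o, 'a, 'z) cat_scheme \<Rightarrow> 'a \<Rightarrow> 'a set \<Rightarrow> 'a set" where
  "pullback_sieve C f S = {g \<in> Arr C. Cod C g = Dom C f \<and> f \<cdot>\<^bsub>C\<^esub> g \<in> S}"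

definition generated_sieve ::
    "('o, 'a, 'z) cat_scheme \<Rightarrow> 'i set \<Rightarrow> ('i \<Rightarrow> 'a) \<Rightarrow> 'a set" where
  "generated_sieve C I f =
     {f i \<cdot>\<^bsub>C\<^esub> g | i g. i \<in> I \<and> g \<in> Arr C \<and> Cod C g = Dom C (f i)}"

definition sieve_contains_family :: "'a set \<Rightarrow> 'i set \<Rightarrow> ('i \<Rightarrow> 'a) \<Rightarrow> bool" where
  "sieve_contains_family S I f \<longleftrightarrow> (\<forall>i\<in>I. f i \<in> S)"

(* J B is the set of covering sieves on B; the first clause makes J B empty when B
   is not an object of C. *)
definition grothendieck_topology ::
    "('o, 'a, 'z) cat_scheme \<Rightarrow> ('o \<Rightarrow> 'a set set) \<Rightarrow> bool" where
  "grothendieck_topology C J \<longleftrightarrow>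
     (\<forall>B. \<forall>S\<in>J B. sieve C B S) \<and>
     (\<forall>B\<in>Obj C. maximal_sieve C B \<in> J B) \<and>
     (\<forall>B. \<forall>S\<in>J B. \<forall>B'\<in>Obj C. \<forall>f\<in>Hom C B' B. pullback_sieve C f S \<in> J B') \<and>
     (\<forall>B. \<forall>S\<in>J B. \<forall>R. sieve C B R \<longrightarrow>
        (\<forall>f\<in>S. pullback_sieve C f R \<in> J (Dom C f)) \<longrightarrow> R \<in> J B)"

definition finite_effective_epi_covering ::
    "('o, 'a, 'z) cat_scheme \<Rightarrow> ('o \<Rightarrow> 'a set set) \<Rightarrow> bool" where
  "finite_effective_epi_covering C J \<longleftrightarrow>
     (\<forall>B I f. finite_effective_epi_family C I f B \<longrightarrow> generated_sieve C I f \<in> J B)"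

(* The intersection of all topologies in which these sieves cover; the lemmas below
   show that it is itself such a topology, hence the smallest one. *)
definition coherent_topology :: "('o, 'a, 'z) cat_scheme \<Rightarrow> 'o \<Rightarrow> 'a set set" where
  "coherent_topology C B =
     {S. sieve C B S \<and>
         (\<forall>J. grothendieck_topology C J \<and> finite_effective_epi_covering C J \<longrightarrow> S \<in> J B)}"

lemma grothendieck_topologyD:
  assumes "grothendieck_topology C J"
  shows "S \<in> J B \<Longrightarrow> sieve C B S"
    and "B \<in> Obj C \<Longrightarrow> maximal_sieve C B \<in> J B"
    and "\<lbrakk>S \<in> J B; B' \<in> Obj C; f \<in> Hom C B' B\<rbrakk> \<Longrightarrow> pullback_sieve C f S \<in> J B'"
    and "\<lbrakk>S \<in> J B; sieve C B R; \<forall>f\<in>S. pullback_sieve C f R \<in> J (Dom C f)\<rbrakk> \<Longrightarrow> R \<in> J B"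
proof -
  note J = assms[unfolded grothendieck_topology_def]
  show "S \<in> J B \<Longrightarrow> sieve C B S"
    by (rule J[THEN conjunct1, rule_format])
  show "B \<in> Obj C \<Longrightarrow> maximal_sieve C B \<in> J B"
    by (rule J[THEN conjunct2, THEN conjunct1, rule_format])
  show "\<lbrakk>S \<in> J B; B' \<in> Obj C; f \<in> Hom C B' B\<rbrakk> \<Longrightarrow> pullback_sieve C f S \<in> J B'"
    by (rule J[THEN conjunct2, THEN conjunct2, THEN conjunct1, rule_format])
  show "R \<in> J B"
    if "S \<in> J B" "sieve C B R" "\<forall>f\<in>S. pullback_sieve C f R \<in> J (Dom C f)"
    by (rule J[THEN conjunct2, THEN conjunct2, THEN conjunct2, rule_format, OF that(1,2)])
       (rule bspec[OF that(3)])
qed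

context category
begin

lemma sieve_maximal: "B \<in> Obj C \<Longrightarrow> sieve C B (maximal_sieve C B)"
  unfolding sieve_def maximal_sieve_def using Comp_Hom by (fastforce simp: Hom_def)

lemma sieve_pullback:
  assumes "sieve C B S" "f \<in> Hom C B' B"
  shows "sieve C B' (pullback_sieve C f S)"
proof -
  have "h \<cdot> g \<in> pullback_sieve C f S"
    if h: "h \<in> pullback_sieve C f S" and Z: "Z \<in> Obj C" and g: "g \<in> Hom C Z (Dom C h)" for h Z g
  proof -
    have hH: "h \<in> Hom C (Dom C h) B'" and fh: "f \<cdot> h \<in> S"
      using h assms(2) by (auto simp: pullback_sieve_def Hom_def)
    have "Dom C (f \<cdot> h) = Dom C h"
      using Comp_Hom[OF hH assms(2)] by (simp add: Hom_def)
    then have "(f \<cdot> h) \<cdot> g \<in> S"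
      using assms(1) fh Z g unfolding sieve_def by metis
    then show ?thesis
      using Comp_assoc[OF g hH assms(2)] Comp_Hom[OF g hH] assms(2)
      by (auto simp: pullback_sieve_def Hom_def)
  qed
  then show ?thesis
    using assms(2) Dom_Obj by (auto simp: sieve_def pullback_sieve_def Hom_def)
qed

lemma sieve_generated:
  assumes "effective_epi_family C I f B"
  shows "sieve C B (generated_sieve C I f)"
proof -
  have f: "f i \<in> Hom C (Dom C (f i)) B" if "i \<in> I" for i
    using assms that by (auto simp: effective_epi_family_def)
  have B: "B \<in> Obj C"
    using assms by (simp add: effective_epi_family_def)
  have 1: "f i \<cdot> g \<in> Hom C (Dom C g) B"
    if "i \<in> I" "g \<in> Arr C" "Cod C g = Dom C (f i)" for i g
    using Comp_Hom[OF _ f[OF that(1)]] that by (simp add: Hom_def)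
  have 2: "h \<cdot> k \<in> generated_sieve C I f"
    if h: "h \<in> generated_sieve C I f" and k: "k \<in> Hom C Z (Dom C h)" for h Z k
  proof -
    obtain i g where ig: "i \<in> I" "g \<in> Arr C" "Cod C g = Dom C (f i)" "h = f i \<cdot> g"
      using h by (auto simp: generated_sieve_def)
    have g: "g \<in> Hom C (Dom C g) (Dom C (f i))" using ig by (simp add: Hom_def)
    have k': "k \<in> Hom C Z (Dom C g)" using k 1[OF ig(1-3)] ig(4) by (simp add: Hom_def)
    have "h \<cdot> k = f i \<cdot> (g \<cdot> k)" using Comp_assoc[OF k' g f[OF ig(1)]] ig(4) by simp
    moreover have "g \<cdot> k \<in> Hom C Z (Dom C (f i))" using Comp_Hom[OF k' g] .
    ultimately show ?thesis using ig(1) by (auto simp: generated_sieve_def Hom_def)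
  qed
  have 3: "generated_sieve C I f \<subseteq> {h \<in> Arr C. Cod C h = B}"
    using 1 by (auto simp: generated_sieve_def Hom_def)
  show ?thesis unfolding sieve_def using B 2 3 by blast
qed

lemma grothendieck_topology_coherent: "grothendieck_topology C (coherent_topology C)"
  unfolding grothendieck_topology_def
proof (intro conjI allI ballI impI)
  fix B S assume "S \<in> coherent_topology C B"
  then show "sieve C B S" by (simp add: coherent_topology_def)
next
  fix B assume "B \<in> Obj C"
  then show "maximal_sieve C B \<in> coherent_topology C B"
    by (simp add: coherent_topology_def sieve_maximal grothendieck_topologyD(2))
next
  fix B S B' f assume "S \<in> coherent_topology C B" "B' \<in> Obj C" "f \<in> Hom C B' B"
  then show "pullback_sieve C f S \<in> coherent_topology C B'"
    by (simp add: coherent_topology_def sieve_pullback[of B S] grothendieck_topologyD(3)[of C _ S B])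
next
  fix B S R
  assume S: "S \<in> coherent_topology C B" and R: "sieve C B R"
    and *: "\<forall>f\<in>S. pullback_sieve C f R \<in> coherent_topology C (Dom C f)"
  have "R \<in> J B" if J: "grothendieck_topology C J" "finite_effective_epi_covering C J" for J
  proof -
    have "S \<in> J B" "\<forall>f\<in>S. pullback_sieve C f R \<in> J (Dom C f)"
      using S * J by (auto simp: coherent_topology_def)
    then show ?thesis by (rule grothendieck_topologyD(4)[OF J(1) _ R])
  qed
  then show "R \<in> coherent_topology C B" using R by (simp add: coherent_topology_def)
qed

lemma finite_effective_epi_covering_coherent:
  "finite_effective_epi_covering C (coherent_topology C)"
  using sieve_generated
  by (auto simp: finite_effective_epi_covering_def finite_effective_epi_family_def
      coherent_topology_def)

lemma coherent_topology_least:
  "\<lbrakk>grothendieck_topology C J; finite_effective_epi_covering C J\<rbrakk>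
     \<Longrightarrow> coherent_topology C B \<subseteq> J B"
  by (auto simp: coherent_topology_def)

end

end

theory Submission
  imports Defs
begin

text \<open>
  A sieve that contains a finite effective epimorphic family contains the sieve generated by it,
  and covering sieves are closed under enlargement; so such a sieve is covering.

  For the converse it suffices that the sieves containing a finite effective epimorphic family
  form a Grothendieck topology, since the coherent topology is the least one in which the
  generated sieves cover. Stability under pullback is precoherence. The substance is transitivity,
  which amounts to saying that if \<open>p\<^sub>i : X\<^sub>i \<rightarrow> B\<close> is effective epimorphic and each \<open>X\<^sub>i\<close> carries a
  finite effective epimorphic family \<open>q\<^sub>i\<^sub>j : Y\<^sub>i\<^sub>j \<rightarrow> X\<^sub>i\<close>, then the composites \<open>p\<^sub>i q\<^sub>i\<^sub>j\<close> are
  effective epimorphic (lemma \<open>effective_epi_family_compose\<close>). A compatible family \<open>e\<^sub>i\<^sub>j\<close>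
  on the \<open>Y\<^sub>i\<^sub>j\<close> descends to morphisms \<open>d\<^sub>i\<close> on the \<open>X\<^sub>i\<close>, and these must be shown compatible in order
  to descend further to \<open>B\<close>. Given \<open>g : Z \<rightarrow> X\<^sub>i\<close> and \<open>h : Z \<rightarrow> X\<^sub>k\<close> with \<open>p\<^sub>i g = p\<^sub>k h\<close>, one would
  like to pull the \<open>q\<^sub>i\<^sub>j\<close> and \<open>q\<^sub>k\<^sub>l\<close> back to \<open>Z\<close>. Fibre products need not exist, and precoherence
  takes their place: one refines \<open>Z\<close> twice by
  finite effective epimorphic families, so that \<open>g\<close> factors through the \<open>q\<^sub>i\<^sub>j\<close> and \<open>h\<close> through the
  \<open>q\<^sub>k\<^sub>l\<close>. There \<open>d\<^sub>i g\<close> and \<open>d\<^sub>k h\<close> agree by the compatibility of \<open>e\<close>, and both refinements can be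
  cancelled because effective epimorphic families are jointly epic.
\<close>

section \<open>Effective epimorphic families and their reindexing\<close>

definition compatible_family ::
    "('o, 'a, 'z) cat_scheme \<Rightarrow> 'i set \<Rightarrow> ('i \<Rightarrow> 'a) \<Rightarrow> 'o \<Rightarrow> ('i \<Rightarrow> 'a) \<Rightarrow> bool" where
  "compatible_family C I f W e \<longleftrightarrow>
     (\<forall>i\<in>I. e i \<in> Hom C (Dom C (f i)) W) \<and>
     (\<forall>i\<in>I. \<forall>j\<in>I. \<forall>Z\<in>Obj C.
        \<forall>g\<in>Hom C Z (Dom C (f i)). \<forall>h\<in>Hom C Z (Dom C (f j)).
          f i \<cdot>\<^bsub>C\<^esub> g = f j \<cdot>\<^bsub>C\<^esub> h \<longrightarrow> e i \<cdot>\<^bsub>C\<^esub> g = e j \<cdot>\<^bsub>C\<^esub> h)"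

lemma compatible_familyD:
  assumes "compatible_family C I f W e"
  shows "i \<in> I \<Longrightarrow> e i \<in> Hom C (Dom C (f i)) W"
    and "\<lbrakk>i \<in> I; j \<in> I; Z \<in> Obj C; g \<in> Hom C Z (Dom C (f i)); h \<in> Hom C Z (Dom C (f j));
          f i \<cdot>\<^bsub>C\<^esub> g = f j \<cdot>\<^bsub>C\<^esub> h\<rbrakk> \<Longrightarrow> e i \<cdot>\<^bsub>C\<^esub> g = e j \<cdot>\<^bsub>C\<^esub> h"
  using assms unfolding compatible_family_def by blast+

lemma effective_epi_family_iff:
  "effective_epi_family C I f B \<longleftrightarrow>
     B \<in> Obj C \<and> (\<forall>i\<in>I. f i \<in> Hom C (Dom C (f i)) B) \<and>
     (\<forall>W\<in>Obj C. \<forall>e. compatible_family C I f W e \<longrightarrow>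
        (\<exists>!d. d \<in> Hom C B W \<and> (\<forall>i\<in>I. d \<cdot>\<^bsub>C\<^esub> f i = e i)))"
  unfolding effective_epi_family_def compatible_family_def by (simp add: imp_conjL)

lemma effective_epi_familyD:
  assumes "effective_epi_family C I f B"
  shows "B \<in> Obj C"
    and "i \<in> I \<Longrightarrow> f i \<in> Hom C (Dom C (f i)) B"
    and "\<lbrakk>W \<in> Obj C; compatible_family C I f W e\<rbrakk> \<Longrightarrow>
           \<exists>!d. d \<in> Hom C B W \<and> (\<forall>i\<in>I. d \<cdot>\<^bsub>C\<^esub> f i = e i)"
  using assms unfolding effective_epi_family_iff by blast+

lemma finite_effective_epi_familyD:
  assumes "finite_effective_epi_family C I f B"
  shows "finite I" and "effective_epi_family C I f B"
  using assms unfolding finite_effective_epi_family_def by blast+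

text \<open>
  Composites are naturally indexed by pairs, whereas finite families have index sets of natural
  numbers; this lemma moves between the two.
\<close>

lemma effective_epi_family_reindex:
  assumes f: "effective_epi_family C I f B" and \<phi>: "bij_betw \<phi> K I"
  shows "effective_epi_family C K (f \<circ> \<phi>) B"
proof -
  let ?\<psi> = "inv_into K \<phi>"
  have K: "\<phi> k \<in> I" "?\<psi> (\<phi> k) = k" if "k \<in> K" for k
    using \<phi> that by (auto simp: bij_betw_def)
  have I: "?\<psi> i \<in> K" "\<phi> (?\<psi> i) = i" if "i \<in> I" for i
    using \<phi> that by (auto simp: bij_betw_def inv_into_into f_inv_into_f)
  have "\<exists>!d. d \<in> Hom C B W \<and> (\<forall>k\<in>K. d \<cdot>\<^bsub>C\<^esub> (f \<circ> \<phi>) k = e k)"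
    if W: "W \<in> Obj C" and e: "compatible_family C K (f \<circ> \<phi>) W e" for W e
  proof -
    have "(e \<circ> ?\<psi>) i \<in> Hom C (Dom C (f i)) W" if "i \<in> I" for i
      using compatible_familyD(1)[OF e I(1)[OF that]] I(2)[OF that] by simp
    moreover have "(e \<circ> ?\<psi>) i \<cdot>\<^bsub>C\<^esub> g = (e \<circ> ?\<psi>) j \<cdot>\<^bsub>C\<^esub> h"
      if "i \<in> I" "j \<in> I" "Z \<in> Obj C" "g \<in> Hom C Z (Dom C (f i))" "h \<in> Hom C Z (Dom C (f j))"
        "f i \<cdot>\<^bsub>C\<^esub> g = f j \<cdot>\<^bsub>C\<^esub> h" for i j Z g h
      using compatible_familyD(2)[OF e I(1)[OF that(1)] I(1)[OF that(2)] that(3)] that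
      by (simp add: I(2))
    ultimately have "compatible_family C I f W (e \<circ> ?\<psi>)"
      unfolding compatible_family_def by blast
    then have ex1: "\<exists>!d. d \<in> Hom C B W \<and> (\<forall>i\<in>I. d \<cdot>\<^bsub>C\<^esub> f i = (e \<circ> ?\<psi>) i)"
      using effective_epi_familyD(3)[OF f W] by blast
    have "(\<forall>i\<in>I. d \<cdot>\<^bsub>C\<^esub> f i = (e \<circ> ?\<psi>) i) \<longleftrightarrow> (\<forall>k\<in>K. d \<cdot>\<^bsub>C\<^esub> (f \<circ> \<phi>) k = e k)" for d
      using K(2) bij_betw_imp_surj_on[OF \<phi>] by auto
    with ex1 show ?thesis by simp
  qed
  then show ?thesis
    unfolding effective_epi_family_iff using effective_epi_familyD(1,2)[OF f] K(1) by simp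
qed

lemma finite_effective_epi_family_of_finite:
  assumes "finite I" "effective_epi_family C I f B"
  shows "\<exists>K \<phi>. bij_betw \<phi> K I \<and> finite_effective_epi_family C K (f \<circ> \<phi>) B"
proof -
  obtain \<phi> where "bij_betw \<phi> {0..<card I} I"
    using ex_bij_betw_nat_finite[OF assms(1)] by blast
  then show ?thesis
    using effective_epi_family_reindex[OF assms(2)]
    unfolding finite_effective_epi_family_def by blast
qed

section \<open>Joint cancellation and sieves in a category\<close>

context category
begin

lemma Hom_Obj: "f \<in> Hom C X Y \<Longrightarrow> X \<in> Obj C" "f \<in> Hom C X Y \<Longrightarrow> Y \<in> Obj C"
  using Dom_Obj Cod_Obj by (auto simp: Hom_def)

lemma Hom_Dom: "f \<in> Hom C X Y \<Longrightarrow> Dom C f = X"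
  by (simp add: Hom_def)

text \<open>
  A morphism out of the target, restricted along the family, is compatible; this is what lets
  the uniqueness clause of effective epimorphic families be read as joint cancellation.
\<close>

lemma effective_epi_family_jointly_epic:
  assumes f: "effective_epi_family C I f B"
    and u: "u \<in> Hom C B W" and v: "v \<in> Hom C B W"
    and eq: "\<And>i. i \<in> I \<Longrightarrow> u \<cdot> f i = v \<cdot> f i"
  shows "u = v"
proof -
  note fH = effective_epi_familyD(2)[OF f]
  have "compatible_family C I f W (\<lambda>i. u \<cdot> f i)"
    unfolding compatible_family_def
  proof (intro conjI ballI impI)
    show "u \<cdot> f i \<in> Hom C (Dom C (f i)) W" if "i \<in> I" for i
      using Comp_Hom[OF fH[OF that] u] .
  next
    fix i j Z g h
    assume "i \<in> I" "j \<in> I" "g \<in> Hom C Z (Dom C (f i))" "h \<in> Hom C Z (Dom C (f j))"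
      "f i \<cdot> g = f j \<cdot> h"
    then show "(u \<cdot> f i) \<cdot> g = (u \<cdot> f j) \<cdot> h"
      using Comp_assoc[OF _ fH u] by simp
  qed
  then have "\<exists>!d. d \<in> Hom C B W \<and> (\<forall>i\<in>I. d \<cdot> f i = u \<cdot> f i)"
    using effective_epi_familyD(3)[OF f Hom_Obj(2)[OF u]] by blast
  then show ?thesis
    using u v eq by (metis (no_types, lifting))
qed

lemma finite_effective_epi_family_Ident:
  assumes B: "B \<in> Obj C"
  shows "finite_effective_epi_family C {0} (\<lambda>_. Ident C B) B"
proof -
  have id: "Ident C B \<in> Hom C B B" using Ident_Hom[OF B] .
  have "\<exists>!d. d \<in> Hom C B W \<and> (\<forall>i\<in>{0::nat}. d \<cdot> Ident C B = e i)"
    if e: "compatible_family C {0} (\<lambda>_. Ident C B) W e" for W e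
  proof -
    have "e 0 \<in> Hom C B W"
      using compatible_familyD(1)[OF e, of 0] by (simp add: Hom_Dom[OF id])
    then show ?thesis using Ident_right by auto
  qed
  then show ?thesis
    unfolding finite_effective_epi_family_def effective_epi_family_iff
    using B id by (simp add: Hom_Dom[OF id])
qed

lemma sieve_Comp:
  assumes "sieve C B S" "h \<in> S" "g \<in> Hom C Z (Dom C h)"
  shows "h \<cdot> g \<in> S"
  using assms Hom_Obj(1)[OF assms(3)] unfolding sieve_def by blast

lemma sieve_Hom: "\<lbrakk>sieve C B S; h \<in> S\<rbrakk> \<Longrightarrow> h \<in> Hom C (Dom C h) B"
  by (auto simp: sieve_def Hom_def)

lemma pullback_sieve_member:
  assumes S: "sieve C B S" and f: "f \<in> S"
  shows "pullback_sieve C f S = maximal_sieve C (Dom C f)"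
  using sieve_Comp[OF S f] by (auto simp: pullback_sieve_def maximal_sieve_def Hom_def)

lemma generated_sieve_subset:
  assumes "sieve C B S" "sieve_contains_family S I f"
  shows "generated_sieve C I f \<subseteq> S"
  using sieve_Comp[OF assms(1)] assms(2)
  by (auto simp: generated_sieve_def sieve_contains_family_def Hom_def)

lemma generated_sieve_contains_family:
  assumes "\<And>i. i \<in> I \<Longrightarrow> f i \<in> Arr C"
  shows "sieve_contains_family (generated_sieve C I f) I f"
  unfolding sieve_contains_family_def
proof
  fix i assume i: "i \<in> I"
  have id: "Ident C (Dom C (f i)) \<in> Hom C (Dom C (f i)) (Dom C (f i))"
    using Ident_Hom[OF Dom_Obj[OF assms[OF i]]] .
  have "f i = f i \<cdot> Ident C (Dom C (f i))"
    using Ident_right[of "f i"] assms[OF i] by (simp add: Hom_def)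
  with i id show "f i \<in> generated_sieve C I f"
    unfolding generated_sieve_def Hom_def by blast
qed

text \<open>
  The pullback of a sieve along one of its own members is maximal, so transitivity lets a larger
  sieve inherit the covering property.
\<close>

lemma grothendieck_topology_mono:
  assumes J: "grothendieck_topology C J"
    and R: "R \<in> J B" and S: "sieve C B S" and sub: "R \<subseteq> S"
  shows "S \<in> J B"
proof (rule grothendieck_topologyD(4)[OF J R S], rule ballI)
  fix f assume f: "f \<in> R"
  then have "Dom C f \<in> Obj C"
    using sieve_Hom[OF S] sub Hom_Obj(1) by blast
  then show "pullback_sieve C f S \<in> J (Dom C f)"
    using pullback_sieve_member[OF S] f sub grothendieck_topologyD(2)[OF J] by auto
qed

end

section \<open>Composition of effective epimorphic families\<close>

context precoherent_category
begin

text \<open>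
  Closure under composition needs precoherence only to check that the morphisms descended to the
  intermediate objects are again compatible; this is the local form of that check.
  Precoherence applies to finite families only, and it is the inner families that are refined
  over \<open>Z\<close>; hence the finiteness of \<open>q\<close> and \<open>q'\<close>.
\<close>

lemma descended_family_compatible:
  assumes p: "p \<in> Hom C X B" and p': "p' \<in> Hom C X' B"
    and q: "finite_effective_epi_family C J q X"
    and q': "finite_effective_epi_family C J' q' X'"
    and d: "d \<in> Hom C X W" and d': "d' \<in> Hom C X' W"
    and g: "g \<in> Hom C Z X" and h: "h \<in> Hom C Z X'" and gh: "p \<cdot> g = p' \<cdot> h"
    and agree: "\<And>j l U a b. \<lbrakk>j \<in> J; l \<in> J'; a \<in> Hom C U (Dom C (q j)); b \<in> Hom C U (Dom C (q' l));
        p \<cdot> (q j \<cdot> a) = p' \<cdot> (q' l \<cdot> b)\<rbrakk> \<Longrightarrow> d \<cdot> (q j \<cdot> a) = d' \<cdot> (q' l \<cdot> b)"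
  shows "d \<cdot> g = d' \<cdot> h"
proof -
  note qH = effective_epi_familyD(2)[OF finite_effective_epi_familyD(2)[OF q]]
  obtain K r where rF: "finite_effective_epi_family C K r Z"
    and rK: "\<forall>k\<in>K. \<exists>j\<in>J. \<exists>a\<in>Hom C (Dom C (r k)) (Dom C (q j)). g \<cdot> r k = q j \<cdot> a"
    using precoherent[OF q g] by blast
  note r = finite_effective_epi_familyD(2)[OF rF]
  note dg = Comp_Hom[OF g d] and dh = Comp_Hom[OF h d']
  show ?thesis
  proof (rule effective_epi_family_jointly_epic[OF r dg dh])
    fix k assume k: "k \<in> K"
    obtain j a where j: "j \<in> J" and a: "a \<in> Hom C (Dom C (r k)) (Dom C (q j))"
      and gr: "g \<cdot> r k = q j \<cdot> a"
      using bspec[OF rK k] by blast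
    have rk: "r k \<in> Hom C (Dom C (r k)) Z"
      using effective_epi_familyD(2)[OF r k] .
    note hr = Comp_Hom[OF rk h]
    obtain L s where sF: "finite_effective_epi_family C L s (Dom C (r k))"
      and sL: "\<forall>l\<in>L.
        \<exists>j\<in>J'. \<exists>b\<in>Hom C (Dom C (s l)) (Dom C (q' j)). (h \<cdot> r k) \<cdot> s l = q' j \<cdot> b"
      using precoherent[OF q' hr] by blast
    note s = finite_effective_epi_familyD(2)[OF sF]
    show "(d \<cdot> g) \<cdot> r k = (d' \<cdot> h) \<cdot> r k"
    proof (rule effective_epi_family_jointly_epic[OF s Comp_Hom[OF rk dg] Comp_Hom[OF rk dh]])
      fix l assume l: "l \<in> L"
      obtain j' b where j': "j' \<in> J'" and b: "b \<in> Hom C (Dom C (s l)) (Dom C (q' j'))"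
        and hrs: "(h \<cdot> r k) \<cdot> s l = q' j' \<cdot> b"
        using bspec[OF sL l] by blast
      have sl: "s l \<in> Hom C (Dom C (s l)) (Dom C (r k))"
        using effective_epi_familyD(2)[OF s l] .
      let ?t = "r k \<cdot> s l"
      have t: "?t \<in> Hom C (Dom C (s l)) Z" using Comp_Hom[OF sl rk] .
      have as: "a \<cdot> s l \<in> Hom C (Dom C (s l)) (Dom C (q j))" using Comp_Hom[OF sl a] .
      have gt: "g \<cdot> ?t = q j \<cdot> (a \<cdot> s l)"
        using Comp_assoc[OF sl rk g] Comp_assoc[OF sl a qH[OF j]] gr by simp
      have ht: "h \<cdot> ?t = q' j' \<cdot> b"
        using Comp_assoc[OF sl rk h] hrs by simp
      have "p \<cdot> (g \<cdot> ?t) = p' \<cdot> (h \<cdot> ?t)"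
        using Comp_assoc[OF t g p] Comp_assoc[OF t h p'] gh by simp
      then have "d \<cdot> (g \<cdot> ?t) = d' \<cdot> (h \<cdot> ?t)"
        using agree[OF j j' as b] gt ht by simp
      then have "(d \<cdot> g) \<cdot> ?t = (d' \<cdot> h) \<cdot> ?t"
        using Comp_assoc[OF t g d] Comp_assoc[OF t h d'] by simp
      then show "((d \<cdot> g) \<cdot> r k) \<cdot> s l = ((d' \<cdot> h) \<cdot> r k) \<cdot> s l"
        using Comp_assoc[OF sl rk dg] Comp_assoc[OF sl rk dh] by simp
    qed
  qed
qed

text \<open>
  Descent happens in two stages: along each inner family to morphisms \<open>d i\<close>, then along the
  outer family; uniqueness cancels the two stages in the opposite order.
\<close>

lemma effective_epi_family_compose:
  assumes p: "effective_epi_family C I p B"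
    and q: "\<And>i. i \<in> I \<Longrightarrow> finite_effective_epi_family C (J i) (q i) (Dom C (p i))"
  shows "effective_epi_family C (Sigma I J) (\<lambda>(i, j). p i \<cdot> q i j) B"
proof -
  let ?pq = "\<lambda>(i, j). p i \<cdot> q i j"
  note pH = effective_epi_familyD(2)[OF p]
  note qE = finite_effective_epi_familyD(2)[OF q]
  note qH = effective_epi_familyD(2)[OF qE]
  have pqH: "p i \<cdot> q i j \<in> Hom C (Dom C (q i j)) B" if "i \<in> I" "j \<in> J i" for i j
    using Comp_Hom[OF qH pH] that by blast
  note pqD = Hom_Dom[OF pqH]
  have "\<exists>!d. d \<in> Hom C B W \<and> (\<forall>x\<in>Sigma I J. d \<cdot> ?pq x = e x)"
    if W: "W \<in> Obj C" and e: "compatible_family C (Sigma I J) ?pq W e" for W e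
  proof -
    have eH: "e (i, j) \<in> Hom C (Dom C (q i j)) W" if "i \<in> I" "j \<in> J i" for i j
      using compatible_familyD(1)[OF e, of "(i, j)"] that by (simp add: pqD)
    have eC: "e (i, j) \<cdot> a = e (k, l) \<cdot> b"
      if i: "i \<in> I" "j \<in> J i" and k: "k \<in> I" "l \<in> J k"
        and a: "a \<in> Hom C Z (Dom C (q i j))" and b: "b \<in> Hom C Z (Dom C (q k l))"
        and eq: "p i \<cdot> (q i j \<cdot> a) = p k \<cdot> (q k l \<cdot> b)" for i j k l Z a b
    proof -
      have "(p i \<cdot> q i j) \<cdot> a = (p k \<cdot> q k l) \<cdot> b"
        using Comp_assoc[OF a qH[OF i] pH[OF i(1)]] Comp_assoc[OF b qH[OF k] pH[OF k(1)]] eq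
        by simp
      then show ?thesis
        using compatible_familyD(2)[OF e, of "(i, j)" "(k, l)" Z a b] i k a b Hom_Obj(1)[OF a]
        by (simp add: pqD)
    qed
    have "\<exists>d. d \<in> Hom C (Dom C (p i)) W \<and> (\<forall>j\<in>J i. d \<cdot> q i j = e (i, j))" if i: "i \<in> I" for i
    proof -
      have "compatible_family C (J i) (q i) W (\<lambda>j. e (i, j))"
        unfolding compatible_family_def
      proof (intro conjI ballI impI)
        show "e (i, j) \<in> Hom C (Dom C (q i j)) W" if "j \<in> J i" for j
          using eH[OF i that] .
        show "e (i, j) \<cdot> a = e (i, l) \<cdot> b"
          if "j \<in> J i" "l \<in> J i" "a \<in> Hom C Z (Dom C (q i j))" "b \<in> Hom C Z (Dom C (q i l))"
            "q i j \<cdot> a = q i l \<cdot> b" for j l Z a b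
          using eC[OF i that(1) i that(2-4)] that(5) by simp
      qed
      then show ?thesis using effective_epi_familyD(3)[OF qE[OF i] W] by blast
    qed
    then obtain d where dH: "\<And>i. i \<in> I \<Longrightarrow> d i \<in> Hom C (Dom C (p i)) W"
      and dq: "\<And>i j. i \<in> I \<Longrightarrow> j \<in> J i \<Longrightarrow> d i \<cdot> q i j = e (i, j)"
      by metis
    have dqa: "d i \<cdot> (q i j \<cdot> a) = e (i, j) \<cdot> a"
      if "i \<in> I" "j \<in> J i" "a \<in> Hom C U (Dom C (q i j))" for i j U a
      using Comp_assoc[OF that(3) qH[OF that(1,2)] dH[OF that(1)]] dq[OF that(1,2)] by simp
    have "d i \<cdot> g = d k \<cdot> h"
      if i: "i \<in> I" and k: "k \<in> I" and g: "g \<in> Hom C Z (Dom C (p i))"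
        and h: "h \<in> Hom C Z (Dom C (p k))" and gh: "p i \<cdot> g = p k \<cdot> h" for i k Z g h
    proof (rule descended_family_compatible[OF pH[OF i] pH[OF k] q[OF i] q[OF k]
            dH[OF i] dH[OF k] g h gh])
      fix j l U a b
      assume j: "j \<in> J i" and l: "l \<in> J k"
        and a: "a \<in> Hom C U (Dom C (q i j))" and b: "b \<in> Hom C U (Dom C (q k l))"
        and eq: "p i \<cdot> (q i j \<cdot> a) = p k \<cdot> (q k l \<cdot> b)"
      show "d i \<cdot> (q i j \<cdot> a) = d k \<cdot> (q k l \<cdot> b)"
        using eC[OF i j k l a b eq] dqa[OF i j a] dqa[OF k l b] by simp
    qed
    then have "compatible_family C I p W d"
      unfolding compatible_family_def using dH by blast
    then obtain c where c: "c \<in> Hom C B W" and cp: "\<And>i. i \<in> I \<Longrightarrow> c \<cdot> p i = d i"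
      using effective_epi_familyD(3)[OF p W] by blast
    have cpq: "c' \<cdot> (p i \<cdot> q i j) = (c' \<cdot> p i) \<cdot> q i j"
      if "c' \<in> Hom C B W" "i \<in> I" "j \<in> J i" for c' i j
      using Comp_assoc[OF qH[OF that(2,3)] pH[OF that(2)] that(1)] by simp
    show ?thesis
    proof (rule ex1I[of _ c])
      show "c \<in> Hom C B W \<and> (\<forall>x\<in>Sigma I J. c \<cdot> ?pq x = e x)"
        using c by (auto simp: cpq[OF c] cp dq)
    next
      fix c' assume c': "c' \<in> Hom C B W \<and> (\<forall>x\<in>Sigma I J. c' \<cdot> ?pq x = e x)"
      then have c'H: "c' \<in> Hom C B W" by blast
      show "c' = c"
      proof (rule effective_epi_family_jointly_epic[OF p c'H c])
        fix i assume i: "i \<in> I"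
        show "c' \<cdot> p i = c \<cdot> p i"
        proof (rule effective_epi_family_jointly_epic[OF qE[OF i]
                Comp_Hom[OF pH[OF i] c'H] Comp_Hom[OF pH[OF i] c]])
          fix j assume j: "j \<in> J i"
          have "c' \<cdot> (p i \<cdot> q i j) = e (i, j)" using c' i j by auto
          then show "(c' \<cdot> p i) \<cdot> q i j = (c \<cdot> p i) \<cdot> q i j"
            using cpq[OF c'H i j] by (simp add: cp[OF i] dq[OF i j])
        qed
      qed
    qed
  qed
  then show ?thesis
    unfolding effective_epi_family_iff using effective_epi_familyD(1)[OF p] pqH
    by (auto simp: pqD)
qed

end

section \<open>The topology of sieves containing a finite effective epimorphic family\<close>

definition finite_epi_sieves :: "('o, 'a, 'z) cat_scheme \<Rightarrow> 'o \<Rightarrow> 'a set set" where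
  "finite_epi_sieves C B =
     {S. sieve C B S \<and>
         (\<exists>I f. finite_effective_epi_family C I f B \<and> sieve_contains_family S I f)}"

context precoherent_category
begin

lemma finite_epi_sieves_transitive:
  assumes S: "S \<in> finite_epi_sieves C B" and R: "sieve C B R"
    and loc: "\<And>f. f \<in> S \<Longrightarrow> pullback_sieve C f R \<in> finite_epi_sieves C (Dom C f)"
  shows "R \<in> finite_epi_sieves C B"
proof -
  obtain I p where p: "finite_effective_epi_family C I p B" and pS: "\<And>i. i \<in> I \<Longrightarrow> p i \<in> S"
    using S unfolding finite_epi_sieves_def sieve_contains_family_def by blast
  have "\<exists>K q. finite_effective_epi_family C K q (Dom C (p i)) \<and>
      (\<forall>j\<in>K. q j \<in> pullback_sieve C (p i) R)" if "i \<in> I" for i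
    using loc[OF pS[OF that]] unfolding finite_epi_sieves_def sieve_contains_family_def by blast
  then obtain J q where
    q: "\<And>i. i \<in> I \<Longrightarrow> finite_effective_epi_family C (J i) (q i) (Dom C (p i))"
    and qR: "\<And>i j. i \<in> I \<Longrightarrow> j \<in> J i \<Longrightarrow> q i j \<in> pullback_sieve C (p i) R"
    by metis
  let ?pq = "\<lambda>(i, j). p i \<cdot> q i j"
  have "finite (Sigma I J)"
    using finite_effective_epi_familyD(1)[OF p] finite_effective_epi_familyD(1)[OF q] by blast
  then obtain K \<phi> where \<phi>: "bij_betw \<phi> K (Sigma I J)"
    and "finite_effective_epi_family C K (?pq \<circ> \<phi>) B"
    using finite_effective_epi_family_of_finite[OF _
        effective_epi_family_compose[OF finite_effective_epi_familyD(2)[OF p] q]] by blast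
  moreover have "?pq x \<in> R" if "x \<in> Sigma I J" for x
    using that qR by (auto simp: pullback_sieve_def)
  then have "sieve_contains_family R K (?pq \<circ> \<phi>)"
    unfolding sieve_contains_family_def using bij_betwE[OF \<phi>] by simp
  ultimately show ?thesis
    unfolding finite_epi_sieves_def using R by blast
qed

lemma finite_epi_sieves_pullback:
  assumes S: "S \<in> finite_epi_sieves C B" and f: "f \<in> Hom C B' B"
  shows "pullback_sieve C f S \<in> finite_epi_sieves C B'"
proof -
  have sS: "sieve C B S" using S by (simp add: finite_epi_sieves_def)
  obtain I p where p: "finite_effective_epi_family C I p B" and pS: "\<And>i. i \<in> I \<Longrightarrow> p i \<in> S"
    using S unfolding finite_epi_sieves_def sieve_contains_family_def by blast
  obtain J q where q: "finite_effective_epi_family C J q B'"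
    and fq: "\<And>j. j \<in> J \<Longrightarrow> \<exists>i\<in>I. \<exists>g\<in>Hom C (Dom C (q j)) (Dom C (p i)). f \<cdot> q j = p i \<cdot> g"
    using precoherent[OF p f] by blast
  have "q j \<in> pullback_sieve C f S" if j: "j \<in> J" for j
  proof -
    have "f \<cdot> q j \<in> S"
      using fq[OF j] sieve_Comp[OF sS pS] by auto
    then show ?thesis
      using effective_epi_familyD(2)[OF finite_effective_epi_familyD(2)[OF q] j] f
      by (simp add: pullback_sieve_def Hom_def)
  qed
  then show ?thesis
    using sieve_pullback[OF sS f] q
    unfolding finite_epi_sieves_def sieve_contains_family_def by blast
qed

lemma grothendieck_topology_finite_epi_sieves: "grothendieck_topology C (finite_epi_sieves C)"
  unfolding grothendieck_topology_def
proof (intro conjI allI ballI impI)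
  show "sieve C B S" if "S \<in> finite_epi_sieves C B" for B S
    using that by (simp add: finite_epi_sieves_def)
  show "maximal_sieve C B \<in> finite_epi_sieves C B" if B: "B \<in> Obj C" for B
  proof -
    have "sieve_contains_family (maximal_sieve C B) {0::nat} (\<lambda>_. Ident C B)"
      using Ident_Hom[OF B] by (simp add: sieve_contains_family_def maximal_sieve_def Hom_def)
    then show ?thesis
      using sieve_maximal[OF B] finite_effective_epi_family_Ident[OF B]
      unfolding finite_epi_sieves_def by blast
  qed
  show "pullback_sieve C f S \<in> finite_epi_sieves C B'"
    if "S \<in> finite_epi_sieves C B" "f \<in> Hom C B' B" for B S B' f
    using finite_epi_sieves_pullback[OF that] .
  show "R \<in> finite_epi_sieves C B"
    if "S \<in> finite_epi_sieves C B" "sieve C B R"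
      "\<forall>f\<in>S. pullback_sieve C f R \<in> finite_epi_sieves C (Dom C f)" for B S R
    using finite_epi_sieves_transitive[OF that(1,2)] that(3) by blast
qed

lemma finite_effective_epi_covering_finite_epi_sieves:
  "finite_effective_epi_covering C (finite_epi_sieves C)"
  unfolding finite_effective_epi_covering_def
proof (intro allI impI)
  fix B I f assume f: "finite_effective_epi_family C I f B"
  note fE = finite_effective_epi_familyD(2)[OF f]
  have "sieve_contains_family (generated_sieve C I f) I f"
    using effective_epi_familyD(2)[OF fE]
    by (intro generated_sieve_contains_family) (auto simp: Hom_def)
  then show "generated_sieve C I f \<in> finite_epi_sieves C B"
    using f sieve_generated[OF fE] unfolding finite_epi_sieves_def by blast
qed

end

section \<open>Covering sieves of the coherent topology\<close>

theorem proposition6p10: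
  fixes C :: "('o, 'a, 'z) cat_scheme" and B :: 'o and S :: "'a set"
  assumes "precoherent_category C"
    and "sieve C B S"
  shows "S \<in> coherent_topology C B \<longleftrightarrow>
    (\<exists>I f. finite_effective_epi_family C I f B \<and> sieve_contains_family S I f)"
proof
  interpret precoherent_category C by (rule assms(1))
  assume "S \<in> coherent_topology C B"
  then have "S \<in> finite_epi_sieves C B"
    using coherent_topology_least[OF grothendieck_topology_finite_epi_sieves
        finite_effective_epi_covering_finite_epi_sieves] by blast
  then show "\<exists>I f. finite_effective_epi_family C I f B \<and> sieve_contains_family S I f"
    by (simp add: finite_epi_sieves_def)
next
  interpret precoherent_category C by (rule assms(1))
  assume "\<exists>I f. finite_effective_epi_family C I f B \<and> sieve_contains_family S I f"
  then obtain I f where f: "finite_effective_epi_family C I f B"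
    and S: "sieve_contains_family S I f" by blast
  have "generated_sieve C I f \<in> coherent_topology C B"
    using finite_effective_epi_covering_coherent f
    unfolding finite_effective_epi_covering_def by blast
  then show "S \<in> coherent_topology C B"
    using grothendieck_topology_mono[OF grothendieck_topology_coherent _ assms(2)]
      generated_sieve_subset[OF assms(2) S] by blast
qed

end
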